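(* Let $p,q$ be positive integers and let $D$ be a degree-$4(p+q)$ pseudo-distribution over $\mathbb R^d$ that satisfies $\{\|u\|^2\le1\}$. Then \[ \Bigl\|\tilde{\mathbb E}_{D(u)}u^{\otimes p}(u^{\otimes q})^{\mathsf T}\Bigr\|\le\Bigl\|\tilde{\mathbb E}_{D(u)}uu^{\mathsf T}\Bigr\|, \] where $\|\cdot\|$ is the spectral norm.
   Context: A degree-$t$ pseudo-distribution over $\mathbb R^d$ is a finitely supported function $D:\mathbb R^d\to\mathbb R$ with $\sum_xD(x)=1$ and $\sum_xD(x)f(x)^2\ge0$ for every polynomial $f$ of degree at most $t/2$; $\tilde{\mathbb E}_Df=\sum_xD(x)f(x)$ entrywise. $D$ satisfies $\{\|u\|^2\le1\}$ if $\tilde{\mathbb E}_D(1-\|u\|^2)^{s}h\ge0$ for $s\in\{0,1\}$ and every sum-of-squares polynomial $h$ with $2s+\deg h\le t$. Here $u^{\otimes p}(u^{\otimes q})^{\mathsf T}$ is a $d^p\times d^q$ matrix. *)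

theory Defs
  imports "HOL-Analysis.Analysis"
begin

text \<open>
  Polynomials on \<open>\<real>\<^sup>d\<close> are identified with the functions they induce, which loses nothing over an
  infinite field.  A multi-index is a function \<open>\<alpha> :: 'd \<Rightarrow> nat\<close>; there are only finitely many with
  total degree at most \<open>k\<close>, so the sum below is a genuine finite sum.
\<close>

definition poly_degree_le :: "nat \<Rightarrow> (real ^ 'd \<Rightarrow> real) \<Rightarrow> bool" where
  "poly_degree_le k f \<longleftrightarrow>
     (\<exists>c :: ('d \<Rightarrow> nat) \<Rightarrow> real.
        \<forall>x. f x = (\<Sum>\<alpha> | (\<Sum>i\<in>UNIV. \<alpha> i) \<le> k. c \<alpha> * (\<Prod>i\<in>UNIV. (x $ i) ^ \<alpha> i)))"

lemma finite_multi_indices: "finite {\<alpha> :: 'd::finite \<Rightarrow> nat. (\<Sum>i\<in>UNIV. \<alpha> i) \<le> k}"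
proof (rule finite_subset)
  show "{\<alpha> :: 'd \<Rightarrow> nat. (\<Sum>i\<in>UNIV. \<alpha> i) \<le> k} \<subseteq> PiE UNIV (\<lambda>_. {..k})"
  proof
    fix \<alpha> :: "'d \<Rightarrow> nat"
    assume "\<alpha> \<in> {\<alpha>. (\<Sum>i\<in>UNIV. \<alpha> i) \<le> k}"
    then have "\<alpha> i \<le> k" for i
      using member_le_sum[of i UNIV \<alpha>] by simp
    then show "\<alpha> \<in> PiE UNIV (\<lambda>_. {..k})" by auto
  qed
  show "finite (PiE (UNIV :: 'd set) (\<lambda>_. {..k}))" by (intro finite_PiE) auto
qed

definition sum_of_squares :: "(real ^ 'd \<Rightarrow> real) \<Rightarrow> bool" where
  "sum_of_squares h \<longleftrightarrow>
     (\<exists>(n :: nat) f. (\<forall>i<n. real_polynomial_function (f i)) \<and> (\<forall>x. h x = (\<Sum>i<n. (f i x)\<^sup>2)))"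

text \<open>For matrix-valued \<open>f\<close> the scalar multiplication and sum act entrywise.\<close>

definition pseudo_expectation ::
    "(real ^ 'd \<Rightarrow> real) \<Rightarrow> (real ^ 'd \<Rightarrow> 'b::real_vector) \<Rightarrow> 'b" where
  "pseudo_expectation D f = (\<Sum>x | D x \<noteq> 0. D x *\<^sub>R f x)"

definition pseudo_distribution :: "nat \<Rightarrow> (real ^ 'd \<Rightarrow> real) \<Rightarrow> bool" where
  "pseudo_distribution t D \<longleftrightarrow>
     finite {x. D x \<noteq> 0} \<and> (\<Sum>x | D x \<noteq> 0. D x) = 1 \<and>
     (\<forall>f. poly_degree_le (t div 2) f \<longrightarrow> 0 \<le> pseudo_expectation D (\<lambda>x. (f x)\<^sup>2))"

text \<open>
  Satisfaction of \<open>\<parallel>u\<parallel>\<^sup>2 \<le> 1\<close> at level \<open>t\<close>.  The bound \<open>2 s + deg h \<le> t\<close> is expressed through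
  an upper bound \<open>k\<close> on \<open>deg h\<close>, so that no truncated subtraction occurs when \<open>t < 2 s\<close>.
\<close>

definition satisfies_unit_ball :: "nat \<Rightarrow> (real ^ 'd \<Rightarrow> real) \<Rightarrow> bool" where
  "satisfies_unit_ball t D \<longleftrightarrow>
     (\<forall>s \<in> {0, 1 :: nat}. \<forall>k h.
        sum_of_squares h \<and> poly_degree_le k h \<and> 2 * s + k \<le> t \<longrightarrow>
        0 \<le> pseudo_expectation D (\<lambda>u. (1 - (norm u)\<^sup>2) ^ s * h u))"

text \<open>
  The tensor power \<open>u\<^sup>\<otimes>\<^sup>p\<close> with \<open>p = CARD('p)\<close>: its \<open>d\<^sup>p\<close> coordinates are indexed by the maps
  from the \<open>p\<close> tensor slots to the coordinates of \<open>u\<close>.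
\<close>

definition tensor_power :: "real ^ 'd \<Rightarrow> real ^ ('p::finite \<Rightarrow> 'd::finite)" where
  "tensor_power u = (\<chi> I. \<Prod>j\<in>UNIV. u $ I j)"

definition outer_product :: "real ^ 'm \<Rightarrow> real ^ 'n \<Rightarrow> real ^ 'n ^ 'm" where
  "outer_product a b = (\<chi> i j. a $ i * b $ j)"

definition spectral_norm :: "real ^ 'n ^ 'm \<Rightarrow> real" where
  "spectral_norm A = onorm ((*v) A)"

end

theory Submission imports Defs begin

text \<open>
  By the pseudo-expectation Cauchy--Schwarz inequality it suffices to bound
  \<open>\<bbbE> \<langle>v, u\<^sup>\<otimes>\<^sup>p\<rangle>\<^sup>2\<close> by \<open>\<lambda> \<parallel>v\<parallel>\<^sup>2\<close>, where \<open>\<lambda>\<close> is the spectral norm of \<open>\<bbbE> u u\<^sup>T\<close>.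
  Splitting off one tensor slot reshapes \<open>v\<close> into a \<open>d \<times> d\<^sup>p\<^sup>-\<^sup>1\<close> matrix \<open>V\<close>, so that
  \<open>\<langle>v, u\<^sup>\<otimes>\<^sup>p\<rangle> = \<langle>V\<^sup>T u, u\<^sup>\<otimes>\<^sup>(\<^sup>p\<^sup>-\<^sup>1\<^sup>)\<rangle>\<close>.  Lagrange's identity is a sum-of-squares proof of
  \<open>\<langle>V\<^sup>T u, u\<^sup>\<otimes>\<^sup>(\<^sup>p\<^sup>-\<^sup>1\<^sup>)\<rangle>\<^sup>2 \<le> \<parallel>V\<^sup>T u\<parallel>\<^sup>2 \<parallel>u\<parallel>\<^sup>2\<^sup>(\<^sup>p\<^sup>-\<^sup>1\<^sup>)\<close>, the ball constraint removes the powers of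
  \<open>\<parallel>u\<parallel>\<^sup>2\<close>, and \<open>\<bbbE> \<parallel>V\<^sup>T u\<parallel>\<^sup>2\<close> is a sum of quadratic forms of \<open>\<bbbE> u u\<^sup>T\<close> at the columns of \<open>V\<close>.
\<close>

section \<open>Closure properties of polynomials of bounded degree\<close>

lemma poly_degree_le_scale:
  assumes "poly_degree_le k f"
  shows "poly_degree_le k (\<lambda>x. a * f x)"
proof -
  obtain c where "\<forall>x. f x = (\<Sum>\<alpha> | (\<Sum>i\<in>UNIV. \<alpha> i) \<le> k. c \<alpha> * (\<Prod>i\<in>UNIV. (x $ i) ^ \<alpha> i))"
    using assms unfolding poly_degree_le_def by blast
  then show ?thesis
    unfolding poly_degree_le_def
    by (intro exI[of _ "\<lambda>\<alpha>. a * c \<alpha>"]) (simp add: sum_distrib_left mult.assoc)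
qed

lemma poly_degree_le_add:
  assumes "poly_degree_le k f" "poly_degree_le k g"
  shows "poly_degree_le k (\<lambda>x. f x + g x)"
proof -
  obtain c d where
    "\<forall>x. f x = (\<Sum>\<alpha> | (\<Sum>i\<in>UNIV. \<alpha> i) \<le> k. c \<alpha> * (\<Prod>i\<in>UNIV. (x $ i) ^ \<alpha> i))"
    "\<forall>x. g x = (\<Sum>\<alpha> | (\<Sum>i\<in>UNIV. \<alpha> i) \<le> k. d \<alpha> * (\<Prod>i\<in>UNIV. (x $ i) ^ \<alpha> i))"
    using assms unfolding poly_degree_le_def by blast
  then show ?thesis
    unfolding poly_degree_le_def
    by (intro exI[of _ "\<lambda>\<alpha>. c \<alpha> + d \<alpha>"]) (simp add: sum.distrib distrib_right)
qed

lemma poly_degree_le_zero: "poly_degree_le k (\<lambda>x. 0)"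
  unfolding poly_degree_le_def by (intro exI[of _ "\<lambda>_. 0"]) simp

lemma poly_degree_le_sum:
  assumes "\<And>a. a \<in> A \<Longrightarrow> poly_degree_le k (f a)"
  shows "poly_degree_le k (\<lambda>x. \<Sum>a\<in>A. f a x)"
  using assms
  by (induction A rule: infinite_finite_induct)
    (simp_all add: poly_degree_le_zero poly_degree_le_add)

lemma poly_degree_le_diff:
  assumes "poly_degree_le k f" "poly_degree_le k g"
  shows "poly_degree_le k (\<lambda>x. f x - g x)"
  using poly_degree_le_add[OF assms(1) poly_degree_le_scale[OF assms(2), of "-1"]] by simp

lemma poly_degree_le_monomial:
  fixes \<alpha> :: "'d::finite \<Rightarrow> nat"
  assumes "(\<Sum>i\<in>UNIV. \<alpha> i) \<le> k"
  shows "poly_degree_le k (\<lambda>x :: real ^ 'd. \<Prod>i\<in>UNIV. (x $ i) ^ \<alpha> i)"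
proof -
  have "(\<Prod>i\<in>UNIV. (x $ i) ^ \<alpha> i) =
      (\<Sum>\<beta> | (\<Sum>i\<in>UNIV. \<beta> i) \<le> k. (if \<beta> = \<alpha> then 1 else 0) * (\<Prod>i\<in>UNIV. (x $ i) ^ \<beta> i))"
    for x :: "real ^ 'd"
    using assms by (simp add: if_distrib[of "\<lambda>t. t * _"] finite_multi_indices cong: if_cong)
  then show ?thesis
    unfolding poly_degree_le_def by (intro exI[of _ "\<lambda>\<beta>. if \<beta> = \<alpha> then 1 else 0"]) blast
qed

lemma poly_degree_le_mult:
  assumes "poly_degree_le k f" "poly_degree_le l g"
  shows "poly_degree_le (k + l) (\<lambda>x. f x * g x)"
proof -
  obtain c d where
    fg: "\<And>x. f x = (\<Sum>\<alpha> | (\<Sum>i\<in>UNIV. \<alpha> i) \<le> k. c \<alpha> * (\<Prod>i\<in>UNIV. (x $ i) ^ \<alpha> i))"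
    "\<And>x. g x = (\<Sum>\<beta> | (\<Sum>i\<in>UNIV. \<beta> i) \<le> l. d \<beta> * (\<Prod>i\<in>UNIV. (x $ i) ^ \<beta> i))"
    using assms unfolding poly_degree_le_def by blast
  have "(\<lambda>x. f x * g x) = (\<lambda>x. \<Sum>\<alpha> | (\<Sum>i\<in>UNIV. \<alpha> i) \<le> k. \<Sum>\<beta> | (\<Sum>i\<in>UNIV. \<beta> i) \<le> l.
      (c \<alpha> * d \<beta>) * (\<Prod>i\<in>UNIV. (x $ i) ^ (\<alpha> i + \<beta> i)))"
    by (simp add: fg sum_product power_add prod.distrib mult_ac)
  moreover have "poly_degree_le (k + l) \<dots>"
    by (intro poly_degree_le_sum poly_degree_le_scale poly_degree_le_monomial)
      (simp add: sum.distrib add_mono)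
  ultimately show ?thesis by simp
qed

lemma poly_degree_le_one: "poly_degree_le k (\<lambda>x. 1)"
  using poly_degree_le_monomial[of "\<lambda>_. 0" k] by simp

text \<open>The constant 1 counts as a polynomial of degree at most \<open>l - k\<close>, so
  multiplying by it raises the bound.\<close>

lemma poly_degree_le_mono:
  assumes "poly_degree_le k f" "k \<le> l"
  shows "poly_degree_le l f"
  using poly_degree_le_mult[OF assms(1) poly_degree_le_one[of "l - k"]] assms(2) by simp

lemma poly_degree_le_coordinate: "poly_degree_le 1 (\<lambda>x :: real ^ 'd. x $ i)"
proof -
  have "(\<Prod>j\<in>UNIV. (x $ j) ^ (if j = i then 1 else 0)) = x $ i" for x :: "real ^ 'd"
    by (simp add: if_distrib[of "\<lambda>t. _ ^ t"] cong: if_cong)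
  then show ?thesis
    using poly_degree_le_monomial[of "\<lambda>j. if j = i then 1 else 0" 1] by simp
qed

lemma poly_degree_le_prod_coordinates:
  assumes "finite A"
  shows "poly_degree_le (card A) (\<lambda>x. \<Prod>j\<in>A. x $ I j)"
  using assms
proof (induction A rule: finite_induct)
  case (insert a A)
  then show ?case
    using poly_degree_le_mult[OF poly_degree_le_coordinate[of "I a"] insert.IH] by simp
qed (simp add: poly_degree_le_one)

lemma poly_degree_le_inner_coordinates:
  assumes "\<And>i. poly_degree_le k (\<lambda>x. F x $ i)"
  shows "poly_degree_le k (\<lambda>x. v \<bullet> F x)"
  unfolding inner_vec_def inner_real_def
  by (intro poly_degree_le_sum poly_degree_le_scale assms)

lemma poly_degree_le_tensor_power:
  "poly_degree_le CARD('p) (\<lambda>u. (tensor_power u :: real ^ ('p::finite \<Rightarrow> 'd::finite)) $ I)"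
  using poly_degree_le_prod_coordinates[of "UNIV :: 'p set" I] by (simp add: tensor_power_def)

text \<open>Bridges two encodings: \<open>sum_of_squares\<close> asks for
  \<open>real_polynomial_function\<close>, while degrees are tracked by coefficient
  families.\<close>

lemma poly_degree_le_imp_real_polynomial_function:
  assumes "poly_degree_le k f"
  shows "real_polynomial_function f"
proof -
  obtain c where "\<forall>x. f x = (\<Sum>\<alpha> | (\<Sum>i\<in>UNIV. \<alpha> i) \<le> k. c \<alpha> * (\<Prod>i\<in>UNIV. (x $ i) ^ \<alpha> i))"
    using assms unfolding poly_degree_le_def by blast
  then have "f = (\<lambda>x. \<Sum>\<alpha> | (\<Sum>i\<in>UNIV. \<alpha> i) \<le> k. c \<alpha> * (\<Prod>i\<in>UNIV. (x $ i) ^ \<alpha> i))"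
    by auto
  moreover have "real_polynomial_function \<dots>"
    by (intro real_polynomial_function_sum finite_multi_indices real_polynomial_function.intros(2,4)
        real_polynomial_function_prod real_polynomial_function_power
        real_polynomial_function.intros(1) bounded_linear_vec_nth finite)
  ultimately show ?thesis by simp
qed

section \<open>Linearity of the pseudo-expectation and bilinear forms of moment matrices\<close>

lemma pseudo_expectation_add:
  "pseudo_expectation D (\<lambda>x. f x + g x) = pseudo_expectation D f + pseudo_expectation D g"
  by (simp add: pseudo_expectation_def scaleR_add_right sum.distrib)

lemma pseudo_expectation_diff:
  "pseudo_expectation D (\<lambda>x. f x - g x) = pseudo_expectation D f - pseudo_expectation D g"
  by (simp add: pseudo_expectation_def scaleR_diff_right sum_subtractf)

lemma pseudo_expectation_sum:
  "pseudo_expectation D (\<lambda>x. \<Sum>a\<in>A. f a x) = (\<Sum>a\<in>A. pseudo_expectation D (f a))"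
  unfolding pseudo_expectation_def scaleR_sum_right by (rule sum.swap)

lemma pseudo_expectation_scale:
  fixes f :: "real ^ 'd \<Rightarrow> real"
  shows "pseudo_expectation D (\<lambda>x. c * f x) = c * pseudo_expectation D f"
  by (simp add: pseudo_expectation_def sum_distrib_left mult_ac)

lemma linear_pseudo_expectation:
  assumes "linear L"
  shows "L (pseudo_expectation D F) = pseudo_expectation D (\<lambda>u. L (F u))"
  using assms by (simp add: pseudo_expectation_def linear_sum linear_scale)

lemma inner_outer_product_mult: "v \<bullet> (outer_product a b *v w) = (v \<bullet> a) * (w \<bullet> b)"
  unfolding inner_vec_def sum_product
  by (simp add: outer_product_def matrix_vector_mult_def sum_distrib_left mult_ac)

text \<open>A bilinear form is linear in its matrix, so it passes through the pseudo-expectation;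
  questions about moment matrices become questions about real polynomials.\<close>

lemma inner_pseudo_expectation_outer_product_mult:
  "v \<bullet> (pseudo_expectation D (\<lambda>u. outer_product (F u) (G u)) *v w) =
    pseudo_expectation D (\<lambda>u. (v \<bullet> F u) * (w \<bullet> G u))"
proof -
  have "linear (\<lambda>A. v \<bullet> (A *v w))"
    by (rule linearI) (simp_all add: matrix_vector_mult_add_rdistrib inner_add_right
        scaleR_matrix_vector_assoc[symmetric])
  then show ?thesis
    by (simp add: linear_pseudo_expectation[where L = "\<lambda>A. v \<bullet> (A *v w)"] inner_outer_product_mult)
qed

section \<open>Positivity, the ball constraint and Cauchy--Schwarz\<close>

lemma pseudo_expectation_square_nonneg:
  assumes "pseudo_distribution t D" "poly_degree_le k f" "2 * k \<le> t"
  shows "0 \<le> pseudo_expectation D (\<lambda>x. (f x)\<^sup>2)"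
proof -
  have "poly_degree_le (t div 2) f"
    using assms(3) by (intro poly_degree_le_mono[OF assms(2)]) simp
  then show ?thesis
    using assms(1) unfolding pseudo_distribution_def by blast
qed

lemma norm_power2_eq_sum: "(norm (u :: real ^ 'd))\<^sup>2 = (\<Sum>i\<in>UNIV. (u $ i)\<^sup>2)"
  unfolding power2_norm_eq_inner by (simp add: inner_vec_def power2_eq_square)

text \<open>The ball constraint removes a single factor \<open>(norm u)\<^sup>2\<close> in front of
  a square. To iterate, another such factor is absorbed into squares
  \<open>(u $ i * f u)\<^sup>2\<close>, summed over \<open>i\<close>. Each
  \<open>u $ i * f u\<close> has degree at most \<open>k + 1\<close>, so the induction varies
  \<open>f\<close> and \<open>k\<close>, and \<open>k + j\<close> is preserved.\<close>

lemma pseudo_expectation_norm_power_mult_square_le: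
  assumes "satisfies_unit_ball t D" "poly_degree_le k f" "2 * (k + j) \<le> t"
  shows "pseudo_expectation D (\<lambda>u. (norm u)\<^sup>2 ^ j * (f u)\<^sup>2) \<le> pseudo_expectation D (\<lambda>u. (f u)\<^sup>2)"
  using assms(2,3)
proof (induction j arbitrary: k f)
  case (Suc j)
  have sos: "sum_of_squares (\<lambda>u. (f u)\<^sup>2)"
    unfolding sum_of_squares_def
    using poly_degree_le_imp_real_polynomial_function[OF Suc.prems(1)]
    by (intro exI[of _ 1] exI[of _ "\<lambda>_. f"]) simp
  have deg: "poly_degree_le (k + k) (\<lambda>u. (f u)\<^sup>2)"
    using poly_degree_le_mult[OF Suc.prems(1) Suc.prems(1)] by (simp add: power2_eq_square)
  \<comment> \<open>The requirement \<open>2 + (k + k) \<le> t\<close> holds because the exponent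
    \<open>Suc j\<close> is at least 1.\<close>
  have "0 \<le> pseudo_expectation D (\<lambda>u. (1 - (norm u)\<^sup>2) ^ 1 * (f u)\<^sup>2)"
    using assms(1) sos deg Suc.prems(2) unfolding satisfies_unit_ball_def
    by (elim ballE[of _ _ 1] allE[of _ "k + k"] allE[of _ "\<lambda>u. (f u)\<^sup>2"]) auto
  then have ball: "pseudo_expectation D (\<lambda>u. (norm u)\<^sup>2 * (f u)\<^sup>2) \<le> pseudo_expectation D (\<lambda>u. (f u)\<^sup>2)"
    by (simp add: left_diff_distrib pseudo_expectation_diff)
  have step: "pseudo_expectation D (\<lambda>u. (norm u)\<^sup>2 ^ j * (u $ i * f u)\<^sup>2)
      \<le> pseudo_expectation D (\<lambda>u. (u $ i * f u)\<^sup>2)" for i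
    using Suc.prems by (intro Suc.IH[OF poly_degree_le_mult[OF poly_degree_le_coordinate]]) auto
  have "pseudo_expectation D (\<lambda>u. (norm u)\<^sup>2 ^ Suc j * (f u)\<^sup>2)
      = (\<Sum>i\<in>UNIV. pseudo_expectation D (\<lambda>u. (norm u)\<^sup>2 ^ j * (u $ i * f u)\<^sup>2))"
    unfolding pseudo_expectation_sum[symmetric]
    by (intro arg_cong[of _ _ "pseudo_expectation D"] ext)
      (simp add: norm_power2_eq_sum sum_distrib_left sum_distrib_right power_mult_distrib mult_ac)
  also have "\<dots> \<le> (\<Sum>i\<in>UNIV. pseudo_expectation D (\<lambda>u. (u $ i * f u)\<^sup>2))"
    by (intro sum_mono step)
  also have "\<dots> = pseudo_expectation D (\<lambda>u. (norm u)\<^sup>2 * (f u)\<^sup>2)"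
    unfolding pseudo_expectation_sum[symmetric]
    by (simp add: norm_power2_eq_sum sum_distrib_right power_mult_distrib)
  finally show ?case
    using ball by simp
qed simp

text \<open>Twice the gap is the sum, over ordered pairs \<open>J\<close>, \<open>L\<close>, of the
  squared 2 by 2 minors \<open>m J u * a L u - m L u * a J u\<close>, each of degree at most
  \<open>k + l\<close>.\<close>

lemma pseudo_expectation_Cauchy_Schwarz_sum:
  assumes "pseudo_distribution t D"
    and "\<And>J. J \<in> K \<Longrightarrow> poly_degree_le k (m J)" "\<And>J. J \<in> K \<Longrightarrow> poly_degree_le l (a J)"
    and "2 * (k + l) \<le> t"
  shows "pseudo_expectation D (\<lambda>u. (\<Sum>J\<in>K. m J u * a J u)\<^sup>2)
    \<le> pseudo_expectation D (\<lambda>u. (\<Sum>J\<in>K. (m J u)\<^sup>2) * (\<Sum>J\<in>K. (a J u)\<^sup>2))"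
proof -
  have lagrange: "2 * ((\<Sum>J\<in>K. (m J u)\<^sup>2) * (\<Sum>J\<in>K. (a J u)\<^sup>2) - (\<Sum>J\<in>K. m J u * a J u)\<^sup>2)
      = (\<Sum>J\<in>K. \<Sum>L\<in>K. (m J u * a L u - m L u * a J u)\<^sup>2)" for u
  proof -
    have "(\<Sum>J\<in>K. \<Sum>L\<in>K. (m J u * a L u - m L u * a J u)\<^sup>2)
        = (\<Sum>J\<in>K. \<Sum>L\<in>K. (m J u)\<^sup>2 * (a L u)\<^sup>2) + (\<Sum>J\<in>K. \<Sum>L\<in>K. (m L u)\<^sup>2 * (a J u)\<^sup>2)
          - 2 * (\<Sum>J\<in>K. \<Sum>L\<in>K. (m J u * a J u) * (m L u * a L u))"
      by (simp add: power2_diff sum.distrib sum_subtractf sum_distrib_left power_mult_distrib mult_ac)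
    moreover have "(\<Sum>J\<in>K. \<Sum>L\<in>K. (m L u)\<^sup>2 * (a J u)\<^sup>2) = (\<Sum>J\<in>K. \<Sum>L\<in>K. (m J u)\<^sup>2 * (a L u)\<^sup>2)"
      by (rule sum.swap)
    ultimately show ?thesis
      by (simp add: sum_product[symmetric] power2_eq_square)
  qed
  have "0 \<le> (\<Sum>J\<in>K. \<Sum>L\<in>K. pseudo_expectation D (\<lambda>u. (m J u * a L u - m L u * a J u)\<^sup>2))"
    by (intro sum_nonneg pseudo_expectation_square_nonneg[OF assms(1) _ assms(4)]
        poly_degree_le_diff poly_degree_le_mult assms)
  then show ?thesis
    unfolding pseudo_expectation_sum[symmetric] lagrange[symmetric]
      pseudo_expectation_scale pseudo_expectation_diff by simp
qed

section \<open>Second moments of linear forms and of tensor powers\<close>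

lemma pseudo_expectation_inner_square_le:
  "pseudo_expectation D (\<lambda>u. (v \<bullet> u)\<^sup>2)
    \<le> spectral_norm (pseudo_expectation D (\<lambda>u. outer_product u u)) * (norm v)\<^sup>2"
proof -
  let ?M = "pseudo_expectation D (\<lambda>u. outer_product u u)"
  have "pseudo_expectation D (\<lambda>u. (v \<bullet> u)\<^sup>2) = v \<bullet> (?M *v v)"
    by (simp add: inner_pseudo_expectation_outer_product_mult power2_eq_square)
  also have "\<dots> \<le> norm v * norm (?M *v v)"
    by (rule norm_cauchy_schwarz)
  also have "\<dots> \<le> norm v * (spectral_norm ?M * norm v)"
    unfolding spectral_norm_def
    by (intro mult_left_mono onorm matrix_vector_mul_bounded_linear) simp
  finally show ?thesis
    by (simp add: power2_eq_square mult_ac)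
qed

text \<open>This is the reshaping of a tensor into a matrix: a map corresponds to its value at
  \<open>s\<close> and its restriction off \<open>s\<close>. Elements of \<open>PiE\<close> are
  \<open>undefined\<close> at \<open>s\<close>, which makes the correspondence bijective.\<close>

lemma sum_functions_split_slot:
  fixes g :: "('p::finite \<Rightarrow> 'd::finite) \<Rightarrow> 'b::comm_monoid_add"
  shows "(\<Sum>I\<in>UNIV. g I) = (\<Sum>J\<in>PiE (UNIV - {s}) (\<lambda>_. UNIV). \<Sum>i\<in>UNIV. g (J(s := i)))"
proof -
  have "(\<Sum>J\<in>PiE (UNIV - {s}) (\<lambda>_. UNIV). \<Sum>i\<in>UNIV. g (J(s := i)))
      = (\<Sum>(J, i)\<in>PiE (UNIV - {s}) (\<lambda>_. UNIV) \<times> UNIV. g (J(s := i)))"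
    by (simp add: sum.cartesian_product)
  also have "\<dots> = (\<Sum>I\<in>UNIV. g I)"
    by (rule sum.reindex_bij_witness[where i = "\<lambda>I. (restrict I (UNIV - {s}), I s)"
          and j = "\<lambda>(J, i). J(s := i)"])
      (auto simp: PiE_def extensional_def restrict_def fun_eq_iff)
  finally show ?thesis by simp
qed

lemma pseudo_expectation_tensor_square_le:
  fixes D :: "real ^ 'd \<Rightarrow> real" and v :: "real ^ ('p::finite \<Rightarrow> 'd)"
  assumes "pseudo_distribution t D" "satisfies_unit_ball t D" "2 * CARD('p) \<le> t"
  shows "pseudo_expectation D (\<lambda>u. (v \<bullet> tensor_power u)\<^sup>2)
    \<le> spectral_norm (pseudo_expectation D (\<lambda>u. outer_product u u)) * (norm v)\<^sup>2"
proof -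
  \<comment> \<open>Any slot will do; \<open>undefined\<close> merely names one.\<close>
  define s :: 'p where "s = undefined"
  define S where "S = UNIV - {s}"
  define K where "K = PiE S (\<lambda>_. UNIV :: 'd set)"
  \<comment> \<open>\<open>col J\<close> is the column of \<open>V\<close> at index
    \<open>J\<close>, and \<open>m J u\<close> the matching entry of the tensor power without slot
    \<open>s\<close>. If \<open>CARD('p) = 1\<close>, then \<open>S\<close> is empty and
    \<open>m J u = 1\<close>.\<close>
  define col :: "('p \<Rightarrow> 'd) \<Rightarrow> real ^ 'd" where "col J = (\<chi> i. v $ (J(s := i)))" for J
  define m where "m J u = (\<Prod>j\<in>S. (u :: real ^ 'd) $ J j)" for J u
  let ?l = "spectral_norm (pseudo_expectation D (\<lambda>u. outer_product u u))"
  have card_S: "Suc (card S) = CARD('p)"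
    by (simp add: S_def card_Diff_singleton)
  have split: "v \<bullet> tensor_power u = (\<Sum>J\<in>K. m J u * (col J \<bullet> u))" for u
  proof -
    have "tensor_power u $ (J(s := i)) = u $ i * m J u" for J i
    proof -
      have "(\<Prod>j\<in>UNIV. u $ (J(s := i)) j) = u $ i * (\<Prod>j\<in>S. u $ (J(s := i)) j)"
        unfolding S_def by (subst prod.remove[of _ s]) auto
      also have "(\<Prod>j\<in>S. u $ (J(s := i)) j) = m J u"
        unfolding m_def by (intro prod.cong) (auto simp: S_def)
      finally show ?thesis by (simp add: tensor_power_def)
    qed
    then show ?thesis
      by (simp add: inner_vec_def sum_functions_split_slot[of _ s] K_def S_def col_def
          sum_distrib_left mult_ac)
  qed
  \<comment> \<open>Expanding the product over \<open>S\<close> of the sums of squared coordinates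
    yields one squared monomial for each \<open>J \<in> K\<close>.\<close>
  have norm_m: "(\<Sum>J\<in>K. (m J u)\<^sup>2) = (norm u)\<^sup>2 ^ card S" for u
  proof -
    have "(\<Sum>J\<in>K. (m J u)\<^sup>2) = (\<Sum>J\<in>K. \<Prod>j\<in>S. (u $ J j)\<^sup>2)"
      by (simp add: m_def prod_power_distrib)
    also have "\<dots> = (\<Prod>j\<in>S. \<Sum>i\<in>UNIV. (u $ i)\<^sup>2)"
      unfolding K_def by (rule prod_sum_PiE[symmetric]) auto
    finally show ?thesis by (simp add: norm_power2_eq_sum)
  qed
  have norm_v: "(\<Sum>J\<in>K. (norm (col J))\<^sup>2) = (norm v)\<^sup>2"
    by (simp add: norm_power2_eq_sum sum_functions_split_slot[of _ s] K_def S_def col_def)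
  have deg_m: "poly_degree_le (card S) (m J)" for J
    unfolding m_def by (intro poly_degree_le_prod_coordinates) simp
  have deg_col: "poly_degree_le 1 (\<lambda>u. col J \<bullet> u)" for J
    by (intro poly_degree_le_inner_coordinates poly_degree_le_coordinate)
  \<comment> \<open>Since \<open>card S + 1 = CARD('p)\<close>, both this step and the removal of
    \<open>card S\<close> factors below fit into degree \<open>2 * CARD('p)\<close>.\<close>
  have "pseudo_expectation D (\<lambda>u. (v \<bullet> tensor_power u)\<^sup>2)
      \<le> pseudo_expectation D (\<lambda>u. (\<Sum>J\<in>K. (m J u)\<^sup>2) * (\<Sum>J\<in>K. (col J \<bullet> u)\<^sup>2))"
    unfolding split
    by (rule pseudo_expectation_Cauchy_Schwarz_sum[OF assms(1) deg_m deg_col])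
      (use assms(3) card_S in simp)
  also have "\<dots> = (\<Sum>J\<in>K. pseudo_expectation D (\<lambda>u. (norm u)\<^sup>2 ^ card S * (col J \<bullet> u)\<^sup>2))"
    by (simp add: norm_m sum_distrib_left pseudo_expectation_sum)
  also have "\<dots> \<le> (\<Sum>J\<in>K. pseudo_expectation D (\<lambda>u. (col J \<bullet> u)\<^sup>2))"
    by (intro sum_mono pseudo_expectation_norm_power_mult_square_le[OF assms(2) deg_col])
      (use assms(3) card_S in simp)
  also have "\<dots> \<le> (\<Sum>J\<in>K. ?l * (norm (col J))\<^sup>2)"
    by (intro sum_mono pseudo_expectation_inner_square_le)
  also have "\<dots> = ?l * (norm v)\<^sup>2"
    by (simp add: sum_distrib_left[symmetric] norm_v)
  finally show ?thesis .
qed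

section \<open>From second moments to the spectral norm\<close>

lemma pseudo_expectation_mult_le:
  assumes "pseudo_distribution t D" "poly_degree_le k f" "poly_degree_le k g" "2 * k \<le> t"
    and "pseudo_expectation D (\<lambda>u. (f u)\<^sup>2) \<le> c * a\<^sup>2"
    and "pseudo_expectation D (\<lambda>u. (g u)\<^sup>2) \<le> c * b\<^sup>2"
    and "a > 0" "b > 0"
  shows "pseudo_expectation D (\<lambda>u. f u * g u) \<le> c * a * b"
proof -
  let ?E = "pseudo_expectation D"
  \<comment> \<open>The weights balance the two bounds: each square term contributes at most
    \<open>c * a\<^sup>2 * b\<^sup>2\<close>, and cancelling \<open>2 * a * b > 0\<close> leaves the
    claim without square roots.\<close>
  have "0 \<le> ?E (\<lambda>u. (b * f u - a * g u)\<^sup>2)"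
    by (intro pseudo_expectation_square_nonneg[OF assms(1) _ assms(4)]
        poly_degree_le_diff poly_degree_le_scale assms(2,3))
  also have "(\<lambda>u. (b * f u - a * g u)\<^sup>2) =
      (\<lambda>u. b\<^sup>2 * (f u)\<^sup>2 + a\<^sup>2 * (g u)\<^sup>2 - (2 * a * b) * (f u * g u))"
    by (simp add: fun_eq_iff power2_eq_square algebra_simps)
  also have "?E \<dots> = b\<^sup>2 * ?E (\<lambda>u. (f u)\<^sup>2) + a\<^sup>2 * ?E (\<lambda>u. (g u)\<^sup>2) - (2 * a * b) * ?E (\<lambda>u. f u * g u)"
    unfolding pseudo_expectation_diff pseudo_expectation_add pseudo_expectation_scale ..
  also have "\<dots> \<le> b\<^sup>2 * (c * a\<^sup>2) + a\<^sup>2 * (c * b\<^sup>2) - (2 * a * b) * ?E (\<lambda>u. f u * g u)"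
    by (intro diff_right_mono add_mono mult_left_mono assms(5,6)) simp_all
  also have "\<dots> = (2 * a * b) * (c * a * b - ?E (\<lambda>u. f u * g u))"
    by (simp add: power2_eq_square algebra_simps)
  finally show ?thesis
    using mult_pos_pos[OF \<open>a > 0\<close> \<open>b > 0\<close>] by (simp add: zero_le_mult_iff)
qed

theorem theorem6p1:
  fixes D :: "real ^ 'd \<Rightarrow> real" and p q :: nat
  assumes "CARD('p::finite) = p" and "CARD('q::finite) = q"
    and "pseudo_distribution (4 * (p + q)) D"
    and "satisfies_unit_ball (4 * (p + q)) D"
  shows "spectral_norm (pseudo_expectation D
           (\<lambda>u. outer_product (tensor_power u :: real ^ ('p \<Rightarrow> 'd))
                               (tensor_power u :: real ^ ('q \<Rightarrow> 'd))))
         \<le> spectral_norm (pseudo_expectation D (\<lambda>u. outer_product u u))"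
proof -
  let ?A = "pseudo_expectation D
           (\<lambda>u. outer_product (tensor_power u :: real ^ ('p \<Rightarrow> 'd))
                               (tensor_power u :: real ^ ('q \<Rightarrow> 'd)))"
  let ?l = "spectral_norm (pseudo_expectation D (\<lambda>u. outer_product u u))"
  have nonneg: "0 \<le> ?l"
    unfolding spectral_norm_def by (intro onorm_pos_le matrix_vector_mul_bounded_linear)
  have "norm (?A *v w) \<le> ?l * norm w" for w
  proof (cases "?A *v w = 0")
    case True
    then show ?thesis using nonneg by simp
  next
    case False
    \<comment> \<open>Testing the matrix against its own image gives
      \<open>(norm v)\<^sup>2\<close>; one factor \<open>norm v > 0\<close> cancels at the
      end.\<close>
    define v where "v = ?A *v w"
    have pos: "norm v > 0" "norm w > 0"
      using False by (auto simp: v_def)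
    have "norm v * norm v = v \<bullet> (?A *v w)"
      by (simp add: v_def norm_eq_sqrt_inner)
    also have "\<dots> = pseudo_expectation D (\<lambda>u. (v \<bullet> tensor_power u) * (w \<bullet> tensor_power u))"
      by (rule inner_pseudo_expectation_outer_product_mult)
    also have "\<dots> \<le> ?l * norm v * norm w"
    \<comment> \<open>Both factors need a common degree bound; \<open>p + q\<close> dominates
      \<open>p\<close> and \<open>q\<close>, and
      \<open>2 * (p + q) \<le> 4 * (p + q)\<close>.\<close>
    proof (rule pseudo_expectation_mult_le[OF assms(3), of "p + q"])
      show "poly_degree_le (p + q) (\<lambda>u. v \<bullet> tensor_power u)"
        by (intro poly_degree_le_inner_coordinates
            poly_degree_le_mono[OF poly_degree_le_tensor_power]) (simp add: assms(1))
      show "poly_degree_le (p + q) (\<lambda>u. w \<bullet> tensor_power u)"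
        by (intro poly_degree_le_inner_coordinates
            poly_degree_le_mono[OF poly_degree_le_tensor_power]) (simp add: assms(2))
    qed (use assms pos in \<open>auto intro!: pseudo_expectation_tensor_square_le\<close>)
    finally show ?thesis
      using pos unfolding v_def[symmetric] by (simp add: mult_ac)
  qed
  then show ?thesis
    unfolding spectral_norm_def[of ?A] by (intro onorm_bound nonneg)
qed

end
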